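(* $$\int_0^1 \ln(-\ln x)\,\frac{1}{(1+x^2)\sqrt{-\ln x}}\,dx = \sqrt{\pi}\sum_{k=0}^{\infty}\frac{(-1)^{k+1}}{\sqrt{2k+1}}\left[\ln(2k+1)+2\ln 2+\gamma\right] = -\left(\ln\sqrt{\frac{8}{\pi}}+\frac{\pi}{4}+\frac{\gamma}{2}\right)\sqrt{\pi}\,\beta\left(\frac12\right).$$
   Context: $\gamma = \lim_{n\to\infty}\left(\sum_{k=1}^n \frac1k - \ln n\right)$ is the Euler-Mascheroni constant. $\beta$ is the Dirichlet beta function, $\beta(s)=\sum_{k=0}^{\infty}\frac{(-1)^k}{(2k+1)^s}$. Infinite series are understood as limits of their partial sums (they need not converge absolutely). *)

theory Defs
  imports "HOL-Analysis.Analysis"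
begin

text \<open>Dirichlet's beta function for real arguments. As \<open>suminf\<close> is the limit of the partial
  sums, conditional convergence suffices for this value to be meaningful.\<close>

definition dirichlet_beta :: "real \<Rightarrow> real" where
  "dirichlet_beta s = (\<Sum>k. (-1) ^ k / (2 * real k + 1) powr s)"

end

theory Submission
  imports Defs "HOL-Real_Asymp.Real_Asymp"
begin

text \<open>
  Let \<open>F(s)\<close> be the integral of \<open>t\<^sup>s\<^sup>-\<^sup>1 / (2 cosh t)\<close> over \<open>t > 0\<close>. Expanding \<open>1 / (2 cosh t)\<close> in powers of
  \<open>exp (- t)\<close> gives \<open>F(s) = \<Gamma>(s) \<beta>(s)\<close> and, with the additional weight \<open>ln t\<close>, the logarithmic series
  as \<open>F'(1/2)\<close>; the substitution \<open>x = exp (- t)\<close> turns the integral in question into \<open>F'(1/2)\<close>.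
  Expanding \<open>1 / cosh\<close> in partial fractions instead, and integrating termwise, gives
  \<open>F(1 - s) = \<Gamma>(1 - s) sin(\<pi>s/2) (2/\<pi>)\<^sup>s F(s)\<close> for \<open>0 < s < 1\<close>. The factor equals 1 at the symmetric point
  \<open>s = 1/2\<close>, so differentiating there determines \<open>F'(1/2) / F(1/2)\<close>.
\<close>

section \<open>Scaling and parameter derivatives of integrals over the half-line\<close>

lemma absolutely_integrable_scale_pos:
  fixes f :: "real \<Rightarrow> real"
  assumes "c > 0" "f absolutely_integrable_on {0<..}"
  shows "(\<lambda>x. f (c * x)) absolutely_integrable_on {0<..}"
    and "integral {0<..} (\<lambda>x. f (c * x)) = integral {0<..} f / c"
proof -
  have img: "(\<lambda>x. c * x) ` {0<..} = {0<..}"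
  proof (intro equalityI subsetI)
    fix y :: real assume "y \<in> {0<..}"
    then show "y \<in> (\<lambda>x. c * x) ` {0<..}"
      using assms(1) by (intro image_eqI[of _ _ "y / c"]) auto
  qed (use assms(1) in auto)
  have "(\<lambda>x. \<bar>c\<bar> * f (c * x)) absolutely_integrable_on {0<..} \<and>
         integral {0<..} (\<lambda>x. \<bar>c\<bar> * f (c * x)) = integral {0<..} f \<longleftrightarrow>
        f absolutely_integrable_on (\<lambda>x. c * x) ` {0<..} \<and>
         integral ((\<lambda>x. c * x) ` {0<..}) f = integral {0<..} f"
    by (rule has_absolute_integral_change_of_variables_1')
       (use assms(1) in \<open>auto intro!: derivative_eq_intros simp: inj_on_def\<close>)
  then have *: "(\<lambda>x. c * f (c * x)) absolutely_integrable_on {0<..}"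
    "integral {0<..} (\<lambda>x. c * f (c * x)) = integral {0<..} f"
    using assms unfolding img by auto
  from *(1) show "(\<lambda>x. f (c * x)) absolutely_integrable_on {0<..}"
    using assms(1) by simp
  from *(2) show "integral {0<..} (\<lambda>x. f (c * x)) = integral {0<..} f / c"
    using assms(1) by (simp add: field_simps)
qed

text \<open>From \<open>|exp u - 1| <= |u| * exp |u|\<close>, with the remaining factor
  \<open>|l|\<close> absorbed through \<open>d * |l| <= exp (d * |l|)\<close>. For
  \<open>l = ln x\<close> the right-hand side is
  \<open>(x powr (2 * d) + x powr (- 2 * d)) / d\<close>, free of \<open>h\<close>: a majorant for
  difference quotients in the exponent of a power of \<open>x\<close>.\<close>

lemma exp_difference_quotient_bound:
  fixes h l d :: real
  assumes "h \<noteq> 0" "\<bar>h\<bar> \<le> d"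
  shows "\<bar>(exp (h * l) - 1) / h\<bar> \<le> (exp (2 * d * l) + exp (- (2 * d * l))) / d"
proof -
  have "d > 0" using assms by linarith
  have 1: "\<bar>exp u - 1\<bar> \<le> \<bar>u\<bar> * exp \<bar>u\<bar>" for u :: real
  proof (cases "u \<ge> 0")
    case True
    have "1 - u \<le> exp (- u)" using exp_ge_add_one_self[of "-u"] by simp
    then have "exp u * (1 - u) \<le> exp u * exp (- u)" by (intro mult_left_mono) auto
    then show ?thesis using True by (simp add: exp_minus algebra_simps)
  next
    case False
    then have "- u * 1 \<le> - u * exp \<bar>u\<bar>" by (intro mult_left_mono) auto
    moreover have "1 - exp u \<le> - u" using exp_ge_add_one_self[of u] by linarith
    ultimately have "1 - exp u \<le> - u * exp \<bar>u\<bar>" by linarith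
    moreover have "\<bar>exp u - 1\<bar> = 1 - exp u" using False by simp
    ultimately show ?thesis using False by simp
  qed
  have hl: "\<bar>h * l\<bar> \<le> d * \<bar>l\<bar>" using assms(2) by (simp add: abs_mult mult_right_mono)
  have "\<bar>(exp (h * l) - 1) / h\<bar> \<le> \<bar>h * l\<bar> * exp \<bar>h * l\<bar> / \<bar>h\<bar>"
    using 1[of "h * l"] by (simp add: divide_right_mono)
  also have "\<dots> = \<bar>l\<bar> * exp \<bar>h * l\<bar>" using assms(1) by (simp add: abs_mult)
  also have "\<dots> \<le> \<bar>l\<bar> * exp (d * \<bar>l\<bar>)" using hl by (intro mult_left_mono) auto
  also have "\<dots> = (d * \<bar>l\<bar>) * exp (d * \<bar>l\<bar>) / d" using \<open>d > 0\<close> by simp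
  also have "\<dots> \<le> exp (d * \<bar>l\<bar>) * exp (d * \<bar>l\<bar>) / d"
    using \<open>d > 0\<close> exp_ge_add_one_self[of "d * \<bar>l\<bar>"]
    by (intro divide_right_mono mult_right_mono) (auto simp del: exp_ge_add_one_self)
  also have "exp (d * \<bar>l\<bar>) * exp (d * \<bar>l\<bar>) = exp (2 * d * \<bar>l\<bar>)"
    by (simp flip: exp_add)
  also have "exp (2 * d * \<bar>l\<bar>) \<le> exp (2 * d * l) + exp (- (2 * d * l))"
    by (cases "l \<ge> 0") auto
  finally show ?thesis using \<open>d > 0\<close> by (simp add: divide_right_mono)
qed

text \<open>Dominated convergence for the difference quotients in \<open>s\<close>. The majorant
  combines the Mellin integrands at two exponents on either side of \<open>s\<close>, so
  integrability without the logarithm throughout the strip is enough.\<close>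

lemma mellin_has_real_derivative:
  fixes f :: "real \<Rightarrow> real"
  assumes nonneg: "\<And>x. x > 0 \<Longrightarrow> f x \<ge> 0"
    and int: "\<And>s. s \<in> {a<..<b} \<Longrightarrow> (\<lambda>x. x powr (s - 1) * f x) integrable_on {0<..}"
    and s: "s \<in> {a<..<b}"
  shows "(\<lambda>x. ln x * x powr (s - 1) * f x) absolutely_integrable_on {0<..}"
    and "((\<lambda>s. integral {0<..} (\<lambda>x. x powr (s - 1) * f x)) has_real_derivative
           integral {0<..} (\<lambda>x. ln x * x powr (s - 1) * f x)) (at s)"
proof -
  \<comment> \<open>The quarter keeps the exponents \<open>s + 2 * d\<close> and
    \<open>s - 2 * d\<close> of the majorant \<open>H\<close> strictly inside the strip.\<close>
  define d where "d = min (s - a) (b - s) / 4"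
  have d: "d > 0" "s + 2 * d \<in> {a<..<b}" "s - 2 * d \<in> {a<..<b}"
    using s by (auto simp: d_def min_def field_simps)
  define q where "q h x = (x powr (s + h - 1) * f x - x powr (s - 1) * f x) / h" for h x
  define H where "H x = (x powr (s + 2 * d - 1) * f x + x powr (s - 2 * d - 1) * f x) / d" for x
  define g where "g x = ln x * x powr (s - 1) * f x" for x
  have powr_add_eq: "x powr (s + h - 1) = x powr (s - 1) * exp (h * ln x)" if "x > 0" for h x
    using that by (simp add: powr_def flip: exp_add) (simp add: algebra_simps)
  have Hint: "H integrable_on {0<..}"
    unfolding H_def by (intro integrable_on_divide integrable_add int d)
  have inside: "s + h \<in> {a<..<b}" if "h \<in> ball 0 d" for h
    using that d by (auto simp: dist_real_def)
  have qint: "q h integrable_on {0<..}" if "h \<in> ball 0 d" for h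
    unfolding q_def using inside[OF that] s by (intro integrable_on_divide integrable_diff int)
  have qH: "norm (q h x) \<le> H x" if "h \<in> ball 0 d" "h \<noteq> 0" "x > 0" for h x
  proof -
    have "q h x = x powr (s - 1) * f x * ((exp (h * ln x) - 1) / h)"
      using that powr_add_eq[of x h] by (simp add: q_def algebra_simps diff_divide_distrib)
    then have "norm (q h x) = x powr (s - 1) * f x * \<bar>(exp (h * ln x) - 1) / h\<bar>"
      using nonneg[OF that(3)] that(3) by (simp add: abs_mult)
    also have "\<dots> \<le> x powr (s - 1) * f x *
                     ((exp (2 * d * ln x) + exp (- (2 * d * ln x))) / d)"
      using nonneg[OF that(3)] that
      by (intro mult_left_mono exp_difference_quotient_bound) (auto simp: dist_real_def)
    also have "\<dots> = H x"
      using powr_add_eq[OF that(3), of "2 * d"] powr_add_eq[OF that(3), of "- 2 * d"]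
      by (simp add: H_def algebra_simps add_divide_distrib)
    finally show ?thesis .
  qed
  have lim: "((\<lambda>h. q h x) \<longlongrightarrow> g x) (at 0)" if "x > 0" for x
  proof -
    have "((\<lambda>s. x powr (s - 1) * f x) has_real_derivative ln x * x powr (s - 1) * f x) (at s)"
      using that by (auto intro!: derivative_eq_intros)
    then show ?thesis unfolding DERIV_def q_def g_def .
  qed
  have at0: "at 0 = at (0::real) within ball 0 d"
    using d(1) by (intro at_within_open[symmetric]) auto
  \<comment> \<open>Dominated convergence speaks of sequences, so the limit at 0 is tested along
    arbitrary null sequences.\<close>
  have conv: "g integrable_on {0<..} \<and> (\<lambda>k. integral {0<..} (q (X k))) \<longlonglongrightarrow> integral {0<..} g"
    if X: "\<And>k. X k \<in> ball 0 d - {0}" "X \<longlonglongrightarrow> 0" for X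
  proof -
    have "(\<lambda>k. q (X k) x) \<longlonglongrightarrow> g x" if "x > 0" for x
      using lim[OF that] X unfolding at0 tendsto_at_iff_sequentially o_def by blast
    then show ?thesis
      using dominated_convergence[of "\<lambda>k. q (X k)" "{0<..}" H g] qint qH Hint X(1) by auto
  qed
  \<comment> \<open>One concrete null sequence yields integrability of \<open>g\<close>; the shift
    by 2 puts even the first term strictly inside the ball.\<close>
  define X where "X k = d / real (k + 2)" for k
  have "X k \<in> ball 0 d - {0}" for k
    using d(1) by (simp add: X_def dist_real_def field_simps add_pos_nonneg)
  moreover have "X \<longlonglongrightarrow> 0"
    unfolding X_def by real_asymp
  ultimately have gint: "g integrable_on {0<..}" using conv by blast
  \<comment> \<open>The majorant survives the limit in \<open>h\<close>, which upgrades
    integrability of \<open>g\<close> to absolute integrability.\<close>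
  have "norm (g x) \<le> H x" if "x > 0" for x
  proof (rule tendsto_upperbound[OF tendsto_norm[OF lim[OF that]]])
    show "\<forall>\<^sub>F h in at 0. norm (q h x) \<le> H x"
      unfolding at0 eventually_at_filter using qH that by auto
  qed auto
  then show "(\<lambda>x. ln x * x powr (s - 1) * f x) absolutely_integrable_on {0<..}"
    using absolutely_integrable_integrable_bound[of "{0<..}" g H] gint Hint
    unfolding g_def by auto
  have "((\<lambda>h. integral {0<..} (q h)) \<longlongrightarrow> integral {0<..} g) (at 0)"
    unfolding at0 tendsto_at_iff_sequentially o_def using conv by blast
  moreover have "integral {0<..} (q h) =
     (integral {0<..} (\<lambda>x. x powr (s + h - 1) * f x) -
      integral {0<..} (\<lambda>x. x powr (s - 1) * f x)) / h" if "h \<in> ball 0 d" for h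
    unfolding q_def using int[OF inside[OF that]] int[OF s]
    by (simp add: integral_diff)
  then have "\<forall>\<^sub>F h in at 0. integral {0<..} (q h) =
     (integral {0<..} (\<lambda>x. x powr (s + h - 1) * f x) -
      integral {0<..} (\<lambda>x. x powr (s - 1) * f x)) / h"
    unfolding at0 eventually_at_filter by auto
  ultimately show "((\<lambda>s. integral {0<..} (\<lambda>x. x powr (s - 1) * f x)) has_real_derivative
           integral {0<..} (\<lambda>x. ln x * x powr (s - 1) * f x)) (at s)"
    unfolding DERIV_def g_def by (rule Lim_transform_eventually)
qed

section \<open>Digamma reflection and Gamma integrals\<close>

text \<open>Both sides of Euler's reflection formula for \<open>Gamma\<close> are differentiated;
  cancelling their common nonzero value leaves an identity of logarithmic derivatives.\<close>

lemma Digamma_reflection_complex: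
  fixes w :: complex
  assumes "w \<notin> \<int>"
  shows "Digamma (1 - w) - Digamma w = of_real pi * cot (of_real pi * w)"
proof -
  have notint: "w \<notin> \<int>\<^sub>\<le>\<^sub>0" "1 - w \<notin> \<int>\<^sub>\<le>\<^sub>0"
    using assms by (auto dest!: nonpos_Ints_Int simp: minus_in_Ints_iff)
  have s: "sin (of_real pi * w) \<noteq> 0"
    using assms by (auto simp: sin_eq_0 mult.commute[of _ "of_real pi"])
  have "((\<lambda>z. Gamma z * Gamma (1 - z)) has_field_derivative
     Gamma w * Gamma (1 - w) * (Digamma w - Digamma (1 - w))) (at w)"
    using notint by (auto intro!: derivative_eq_intros simp: algebra_simps)
  moreover have "((\<lambda>z. of_real pi / sin (of_real pi * z)) has_field_derivative
     - (of_real pi / sin (of_real pi * w) * (of_real pi * cot (of_real pi * w)))) (at w)"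
    using s by (auto intro!: derivative_eq_intros simp: cot_def field_simps)
  moreover have "(\<lambda>z. Gamma z * Gamma (1 - z)) = (\<lambda>z. complex_of_real pi / sin (of_real pi * z))"
    by (intro ext Gamma_reflection_complex)
  ultimately have "Gamma w * Gamma (1 - w) * (Digamma w - Digamma (1 - w)) =
     - (of_real pi / sin (of_real pi * w) * (of_real pi * cot (of_real pi * w)))"
    by (metis DERIV_unique)
  then have "of_real pi / sin (of_real pi * w) * (Digamma w - Digamma (1 - w)) =
     of_real pi / sin (of_real pi * w) * - (of_real pi * cot (of_real pi * w))"
    by (simp add: Gamma_reflection_complex)
  then have "Digamma w - Digamma (1 - w) = - (of_real pi * cot (of_real pi * w))"
    using s by (subst (asm) mult_cancel_left) auto
  then show ?thesis by (simp add: algebra_simps)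
qed

text \<open>Euler's integral rescaled by \<open>c\<close>. With \<open>c = 2 * k + 1\<close> it
  evaluates the terms of the expansion of \<open>1 / (2 * cosh t)\<close>.\<close>

lemma Gamma_integral_exp:
  fixes s c :: real
  assumes "s > 0" "c > 0"
  shows "(\<lambda>t. t powr (s - 1) * exp (- (c * t))) absolutely_integrable_on {0<..}"
    and "integral {0<..} (\<lambda>t. t powr (s - 1) * exp (- (c * t))) = Gamma s / c powr s"
proof -
  have "((\<lambda>t. t powr (s - 1) * exp (- t)) has_integral Gamma s) {0..}"
    using Gamma_integral_real[OF assms(1)] by (simp add: exp_minus field_simps)
  then have *: "((\<lambda>t. t powr (s - 1) * exp (- t)) has_integral Gamma s) {0<..}"
    by (rule has_integral_spike_set_eq[THEN iffD1, rotated -1])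
       (auto intro: negligible_subset[of "{0::real}"])
  then have **: "(\<lambda>t. t powr (s - 1) * exp (- t)) absolutely_integrable_on {0<..}"
    by (intro nonnegative_absolutely_integrable_1) auto
  note sc = absolutely_integrable_scale_pos[OF assms(2) **]
  have eq: "(c * t) powr (s - 1) * exp (- (c * t)) =
      c powr (s - 1) * (t powr (s - 1) * exp (- (c * t)))" if "t \<in> {0<..}" for t
    using that assms by (simp add: powr_mult)
  have "(\<lambda>t. c powr (s - 1) * (t powr (s - 1) * exp (- (c * t)))) absolutely_integrable_on {0<..}"
    using sc(1) by (simp only: set_integrable_cong[OF refl refl eq])
  then show "(\<lambda>t. t powr (s - 1) * exp (- (c * t))) absolutely_integrable_on {0<..}"
    using assms by simp
  have "Gamma s / c = integral {0<..} (\<lambda>t. c powr (s - 1) * (t powr (s - 1) * exp (- (c * t))))"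
    using sc(2) integral_unique[OF *] by (simp only: integral_cong[OF eq])
  then show "integral {0<..} (\<lambda>t. t powr (s - 1) * exp (- (c * t))) = Gamma s / c powr s"
    unfolding integral_mult_right using assms by (simp add: powr_diff divide_simps)
qed

text \<open>Derivative in \<open>s\<close> of the preceding evaluation:
  \<open>Gamma s / c powr s\<close> has logarithmic derivative
  \<open>Digamma s - ln c\<close>.\<close>

lemma Gamma_integral_ln_exp:
  fixes s c :: real
  assumes "s > 0" "c > 0"
  shows "(\<lambda>t. ln t * t powr (s - 1) * exp (- (c * t))) absolutely_integrable_on {0<..}"
    and "integral {0<..} (\<lambda>t. ln t * t powr (s - 1) * exp (- (c * t))) =
           Gamma s / c powr s * (Digamma s - ln c)"
proof -
  \<comment> \<open>The differentiation lemma works on a bounded strip; \<open>s + 1\<close> is an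
    arbitrary upper end beyond \<open>s\<close>.\<close>
  have int: "(\<lambda>t. t powr (u - 1) * exp (- (c * t))) integrable_on {0<..}" if "u \<in> {0<..<s + 1}" for u
    using Gamma_integral_exp(1)[of u c] that assms set_lebesgue_integral_eq_integral(1) by auto
  have s: "s \<in> {0<..<s + 1}" using assms by auto
  note mellin = mellin_has_real_derivative[of "\<lambda>t. exp (- (c * t))" 0 "s + 1" s, OF _ int s]
  show "(\<lambda>t. ln t * t powr (s - 1) * exp (- (c * t))) absolutely_integrable_on {0<..}"
    using mellin(1) by auto
  have "((\<lambda>u. Gamma u / c powr u) has_real_derivative
          integral {0<..} (\<lambda>t. ln t * t powr (s - 1) * exp (- (c * t)))) (at s)"
  proof (rule has_field_derivative_transform_within_open[of _ _ _ "{0<..}"])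
    show "((\<lambda>s. integral {0<..} (\<lambda>t. t powr (s - 1) * exp (- (c * t)))) has_real_derivative
       integral {0<..} (\<lambda>t. ln t * t powr (s - 1) * exp (- (c * t)))) (at s)"
      using mellin(2) by auto
  qed (use assms Gamma_integral_exp(2) in auto)
  moreover have "((\<lambda>u. Gamma u / c powr u) has_real_derivative
          Gamma s / c powr s * (Digamma s - ln c)) (at s)"
    using assms by (auto intro!: derivative_eq_intros elim!: nonpos_Ints_cases simp: field_simps)
  ultimately show "integral {0<..} (\<lambda>t. ln t * t powr (s - 1) * exp (- (c * t))) =
           Gamma s / c powr s * (Digamma s - ln c)"
    by (rule DERIV_unique)
qed

section \<open>Expansion of sech in exponentials\<close>

text \<open>A geometric series in \<open>- exp (- 2 * t)\<close>, integrated by dominated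
  convergence of its partial sums, so the resulting series may converge only conditionally. The
  general weight \<open>w\<close> serves both \<open>t powr (s - 1)\<close> and its product with
  \<open>ln t\<close>.\<close>

lemma sech_weighted_integral_sums:
  fixes w :: "real \<Rightarrow> real"
  assumes int: "\<And>k. (\<lambda>t. w t * exp (- ((2 * real k + 1) * t))) absolutely_integrable_on {0<..}"
  shows "(\<lambda>t. w t / (2 * cosh t)) absolutely_integrable_on {0<..}"
    and "(\<lambda>k. (-1) ^ k * integral {0<..} (\<lambda>t. w t * exp (- ((2 * real k + 1) * t)))) sums
           integral {0<..} (\<lambda>t. w t / (2 * cosh t))"
proof -
  define e where "e k t = w t * exp (- ((2 * real k + 1) * t))" for k t
  define S where "S N t = (\<Sum>k<N. (-1) ^ k * e k t)" for N t
  define H where "H t = 2 * norm (e 0 t)" for t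
  have eint: "e k integrable_on {0<..}" for k
    using int[of k] set_lebesgue_integral_eq_integral(1) unfolding e_def by blast
  have S_int: "S N integrable_on {0<..}" for N
    unfolding S_def by (intro integrable_sum integrable_on_mult_right eint) auto
  have H_int: "H integrable_on {0<..}"
    using int[of 0] unfolding absolutely_integrable_on_def H_def e_def
    by (intro integrable_on_mult_right) auto
  \<comment> \<open>The closed form of the partial sums bounds them by an integrable function although the series of
    norms need not be integrable.\<close>
  have S_eq: "S N t = w t * exp (- t) * ((1 - (- exp (- 2 * t)) ^ N) / (1 + exp (- 2 * t)))" for N t
  proof -
    have "exp (- ((2 * real k + 1) * t)) = exp (- t) * exp (- 2 * t) ^ k" for k
      by (simp flip: exp_of_nat_mult exp_add) (simp add: algebra_simps)
    then have "S N t = w t * exp (- t) * (\<Sum>k<N. (- exp (- 2 * t)) ^ k)"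
      unfolding S_def e_def sum_distrib_left
      by (intro sum.cong refl) (simp flip: power_mult_distrib)
    moreover have "- exp (- 2 * t) \<noteq> 1"
      using exp_gt_zero[of "- 2 * t"] by linarith
    ultimately show ?thesis
      by (simp add: sum_gp_strict)
  qed
  have le: "norm (S N t) \<le> H t" if "t \<in> {0<..}" for N t
  proof -
    have "\<bar>(- exp (- 2 * t)) ^ N\<bar> \<le> 1"
      using that by (simp add: power_abs power_le_one)
    then have "\<bar>1 - (- exp (- 2 * t)) ^ N\<bar> \<le> 2" by linarith
    then have "\<bar>(1 - (- exp (- 2 * t)) ^ N) / (1 + exp (- 2 * t))\<bar> \<le> 2 / 1"
      unfolding abs_divide by (intro frac_le) auto
    then have "norm (w t * exp (- t)) * \<bar>(1 - (- exp (- 2 * t)) ^ N) / (1 + exp (- 2 * t))\<bar>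
        \<le> norm (w t * exp (- t)) * 2"
      by (intro mult_left_mono) auto
    then show ?thesis unfolding S_eq H_def e_def by (simp add: abs_mult)
  qed
  have lim: "(\<lambda>N. S N t) \<longlonglongrightarrow> w t / (2 * cosh t)" if "t \<in> {0<..}" for t
  proof -
    have "(\<lambda>N. (- exp (- 2 * t)) ^ N) \<longlonglongrightarrow> 0"
      using that by (intro LIMSEQ_power_zero) auto
    then have "(\<lambda>N. S N t) \<longlonglongrightarrow> w t * exp (- t) * ((1 - 0) / (1 + exp (- 2 * t)))"
      unfolding S_eq by (intro tendsto_intros \<open>(\<lambda>N. (- exp (- 2 * t)) ^ N) \<longlonglongrightarrow> 0\<close>)
        (use add_pos_pos[OF zero_less_one exp_gt_zero[of "- 2 * t"]] in linarith)
    moreover have "w t * exp (- t) * ((1 - 0) / (1 + exp (- 2 * t))) = w t / (2 * cosh t)"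
    proof -
      have "exp (- t) / (1 + exp (- 2 * t)) = 1 / (2 * cosh t)"
      proof -
        have "exp (- t) * (2 * cosh t) = 1 + exp (- 2 * t)"
          by (simp add: cosh_def ring_distribs flip: exp_add)
        moreover have "2 * cosh t > 0" by simp
        moreover have "1 + exp (- 2 * t) > 0" by (simp add: add_pos_pos)
        ultimately show ?thesis by (simp add: field_simps)
      qed
      then show ?thesis
        by (metis (no_types, lifting) diff_zero mult.assoc mult.right_neutral times_divide_eq_right)
    qed
    ultimately show ?thesis by (simp only:)
  qed
  note dc = dominated_convergence[of S "{0<..}" H "\<lambda>t. w t / (2 * cosh t)", OF S_int H_int le lim]
  have "norm (w t / (2 * cosh t)) \<le> H t" if "t \<in> {0<..}" for t
    by (rule tendsto_upperbound[OF tendsto_norm[OF lim[OF that]] always_eventually])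
       (simp_all only: le[OF that] simp_thms sequentially_bot not_False_eq_True)
  then show "(\<lambda>t. w t / (2 * cosh t)) absolutely_integrable_on {0<..}"
    by (rule absolutely_integrable_integrable_bound[OF _ dc(1) H_int])
  have "integral {0<..} (S N) = (\<Sum>k<N. (-1) ^ k * integral {0<..} (e k))" for N
    unfolding S_def
    by (subst integral_sum) (simp_all add: integrable_on_mult_right eint)
  with dc(2) show "(\<lambda>k. (-1) ^ k * integral {0<..} (\<lambda>t. w t * exp (- ((2 * real k + 1) * t)))) sums
           integral {0<..} (\<lambda>t. w t / (2 * cosh t))"
    unfolding sums_def e_def by simp
qed

section \<open>Mellin transform of the Cauchy kernel\<close>

lemma Gamma_reflection_real:
  fixes x :: real
  shows "Gamma x * Gamma (1 - x) = pi / sin (pi * x)"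
proof -
  have "complex_of_real (Gamma x * Gamma (1 - x)) = of_real (pi / sin (pi * x))"
    using Gamma_reflection_complex[of "of_real x"]
    by (simp flip: Gamma_complex_of_real sin_of_real)
  then show ?thesis by (simp only: of_real_eq_iff)
qed

text \<open>The substitution \<open>y = x\<^sup>2 / (1 + x\<^sup>2)\<close> turns this into a Beta integral.\<close>

lemma mellin_Cauchy_kernel_unit:
  fixes s :: real
  assumes "0 < s" "s < 2"
  shows "(\<lambda>x. x powr (s - 1) * (1 / (1 + x\<^sup>2))) absolutely_integrable_on {0<..}"
    and "integral {0<..} (\<lambda>x. x powr (s - 1) * (1 / (1 + x\<^sup>2))) = pi / 2 / sin (pi * s / 2)"
proof -
  define B where "B t = t powr (s / 2 - 1) * (1 - t) powr (- (s / 2))" for t :: real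
  define g where "g x = x\<^sup>2 / (1 + x\<^sup>2)" for x :: real
  have pos: "1 + x\<^sup>2 > 0" for x :: real by (simp add: add_pos_nonneg)
  \<comment> \<open>The two arguments add up to 1, so the Beta value is a product of the kind in the
    reflection formula.\<close>
  have Beta_eq: "Beta (s / 2) (1 - s / 2) = pi / sin (pi * s / 2)"
    using Gamma_reflection_real[of "s / 2"] by (simp add: Beta_def)
  have "(B has_integral pi / sin (pi * s / 2)) {0..1}"
    using has_integral_Beta_real[of "s / 2" "1 - s / 2"] assms
    unfolding Beta_eq B_def by simp
  then have B1: "(B has_integral pi / sin (pi * s / 2)) {0<..<1}"
    by (simp add: has_integral_Icc_iff_Ioo)
  then have B2: "B absolutely_integrable_on {0<..<1}"
    by (intro nonnegative_absolutely_integrable_1) (auto simp: B_def)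
  have img: "g ` {0<..} = {0<..<1}"
  proof (intro equalityI subsetI)
    fix y :: real assume y: "y \<in> {0<..<1}"
    have "1 + y / (1 - y) = 1 / (1 - y)" using y by (simp add: field_simps)
    then have "y = g (sqrt (y / (1 - y)))"
      using y by (simp add: g_def)
    then show "y \<in> g ` {0<..}" using y by (intro image_eqI) auto
  qed (use pos in \<open>auto simp: g_def add_pos_nonneg\<close>)
  have inj: "inj_on g {0<..}"
  proof (rule inj_onI)
    fix x y :: real assume "x \<in> {0<..}" "y \<in> {0<..}" "g x = g y"
    then have "x\<^sup>2 = y\<^sup>2"
      using pos[of x] pos[of y] by (simp add: g_def field_simps)
    then show "x = y" using \<open>x \<in> {0<..}\<close> \<open>y \<in> {0<..}\<close> by (simp add: power2_eq_iff_nonneg)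
  qed
  define g' where "g' x = 2 * x / (1 + x\<^sup>2)\<^sup>2" for x :: real
  have der: "(g has_field_derivative g' x) (at x within {0<..})" for x
    unfolding g_def g'_def using pos[of x]
    by (auto intro!: derivative_eq_intros simp: field_simps power2_eq_square)
  have cv: "(\<lambda>x. \<bar>g' x\<bar> * B (g x)) absolutely_integrable_on {0<..} \<and>
         integral {0<..} (\<lambda>x. \<bar>g' x\<bar> * B (g x)) = pi / sin (pi * s / 2)"
    using has_absolute_integral_change_of_variables_1'[OF _ der inj, of B "pi / sin (pi * s / 2)"]
      B1 B2 unfolding img by (auto simp: integral_unique)
  \<comment> \<open>The factor 2 comes from \<open>g'\<close> and accounts for \<open>pi / 2\<close>
    instead of \<open>pi\<close> in the result.\<close>
  have eq: "\<bar>g' x\<bar> * B (g x) = 2 * (x powr (s - 1) * (1 / (1 + x\<^sup>2)))" if "x \<in> {0<..}" for x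
  proof -
    have x: "x > 0" using that by simp
    have "1 - g x = 1 / (1 + x\<^sup>2)" using pos[of x] by (simp add: g_def field_simps)
    then have "B (g x) = (x\<^sup>2) powr (s / 2 - 1) / (1 + x\<^sup>2) powr (s / 2 - 1) * (1 + x\<^sup>2) powr (s / 2)"
      using pos[of x] x by (simp add: B_def g_def powr_divide powr_minus_divide)
    also have "(x\<^sup>2) powr (s / 2 - 1) = x powr (s - 2)"
      using x by (simp add: powr_powr flip: powr_numeral)
    also have "x powr (s - 2) / (1 + x\<^sup>2) powr (s / 2 - 1) * (1 + x\<^sup>2) powr (s / 2) =
        x powr (s - 2) * (1 + x\<^sup>2)"
      using pos[of x] by (simp add: powr_diff)
    finally have "\<bar>g' x\<bar> * B (g x) = 2 * (x * x powr (s - 2)) * (1 / (1 + x\<^sup>2))"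
      using x pos[of x] by (simp add: g'_def power2_eq_square)
    also have "x * x powr (s - 2) = x powr (s - 1)"
      using x by (simp add: powr_mult_base)
    finally show ?thesis by simp
  qed
  have "(\<lambda>x. 2 * (x powr (s - 1) * (1 / (1 + x\<^sup>2)))) absolutely_integrable_on {0<..}"
    using conjunct1[OF cv] by (simp only: set_integrable_cong[OF refl refl eq])
  then show "(\<lambda>x. x powr (s - 1) * (1 / (1 + x\<^sup>2))) absolutely_integrable_on {0<..}"
    by (subst (asm) set_integrable_mult_right_iff) auto
  have "integral {0<..} (\<lambda>x. 2 * (x powr (s - 1) * (1 / (1 + x\<^sup>2)))) = pi / sin (pi * s / 2)"
    using conjunct2[OF cv] by (simp only: integral_cong[OF eq])
  then show "integral {0<..} (\<lambda>x. x powr (s - 1) * (1 / (1 + x\<^sup>2))) = pi / 2 / sin (pi * s / 2)"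
    by (subst (asm) integral_mult_right) auto
qed

lemma mellin_Cauchy_kernel:
  fixes s c :: real
  assumes "0 < s" "s < 2" "c > 0"
  shows "(\<lambda>x. x powr (s - 1) * (c / (c\<^sup>2 + x\<^sup>2))) absolutely_integrable_on {0<..}"
    and "integral {0<..} (\<lambda>x. x powr (s - 1) * (c / (c\<^sup>2 + x\<^sup>2))) =
           pi / 2 / sin (pi * s / 2) * c powr (s - 1)"
proof -
  have c: "1 / c > 0" using assms by simp
  note sc = absolutely_integrable_scale_pos[OF c mellin_Cauchy_kernel_unit(1)[OF assms(1,2)]]
  \<comment> \<open>Replacing \<open>x\<close> by \<open>x / c\<close> takes
    \<open>c powr (s - 1)\<close> out of the power and \<open>1 / c\<close> out of the kernel, hence
    \<open>c powr (s - 2)\<close>; the Jacobian of the scaling restores one factor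
    \<open>c\<close>.\<close>
  have eq: "c powr (s - 2) * ((1 / c * x) powr (s - 1) * (1 / (1 + (1 / c * x)\<^sup>2))) =
       x powr (s - 1) * (c / (c\<^sup>2 + x\<^sup>2))" if "x \<in> {0<..}" for x
  proof -
    have "1 / (1 + (1 / c * x)\<^sup>2) = c\<^sup>2 / (c\<^sup>2 + x\<^sup>2)"
      using assms that by (simp add: field_simps)
    moreover have "(1 / c * x) powr (s - 1) = x powr (s - 1) / c powr (s - 1)"
      using assms that by (simp add: powr_divide)
    moreover have "c powr (s - 2) = c powr (s - 1) / c"
      using assms by (simp add: powr_diff power2_eq_square)
    ultimately show ?thesis
      using assms by (simp add: power2_eq_square)
  qed
  have "(\<lambda>x. c powr (s - 2) * ((1 / c * x) powr (s - 1) * (1 / (1 + (1 / c * x)\<^sup>2))))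
          absolutely_integrable_on {0<..}"
    using sc(1) by (intro set_integrable_mult_right)
  then show "(\<lambda>x. x powr (s - 1) * (c / (c\<^sup>2 + x\<^sup>2))) absolutely_integrable_on {0<..}"
    by (simp only: set_integrable_cong[OF refl refl eq])
  have "integral {0<..} (\<lambda>x. x powr (s - 1) * (c / (c\<^sup>2 + x\<^sup>2))) =
     c powr (s - 2) * (pi / 2 / sin (pi * s / 2) / (1 / c))"
    by (subst integral_cong[OF eq, symmetric], assumption)
       (simp only: integral_mult_right sc(2) mellin_Cauchy_kernel_unit(2)[OF assms(1,2)])
  also have "\<dots> = pi / 2 / sin (pi * s / 2) * c powr (s - 1)"
    using assms powr_mult_base[of c "s - 2"] by (simp add: mult.commute)
  finally show "integral {0<..} (\<lambda>x. x powr (s - 1) * (c / (c\<^sup>2 + x\<^sup>2))) =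
           pi / 2 / sin (pi * s / 2) * c powr (s - 1)" .
qed

section \<open>Partial fractions of sech\<close>

text \<open>The terms \<open>1 / (k + 1)\<close> and the Euler-Mascheroni constant in the series for
  \<open>Digamma\<close> cancel in the difference.\<close>

lemma Digamma_diff_sums:
  fixes a b :: complex
  assumes "a \<noteq> 0" "b \<noteq> 0"
  shows "(\<lambda>k. inverse (a + of_nat k) - inverse (b + of_nat k)) sums (Digamma b - Digamma a)"
  using sums_diff[OF summable_sums[OF summable_Digamma[OF assms(2)]]
                     summable_sums[OF summable_Digamma[OF assms(1)]]]
  by (simp add: Digamma_def)

text \<open>The two arguments add up to \<open>pi / 2\<close>. So
  \<open>sin (a + b) / (sin a * sin b)\<close> has numerator 1, and the product formula for the
  sines loses its \<open>cos (a + b)\<close> term, leaving the denominator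
  \<open>cosh (2 * v) / 2\<close>.\<close>

lemma cot_add_cot_conjugates:
  fixes v :: real
  shows "cot (of_real (pi / 4) + \<i> * of_real v) + cot (of_real (pi / 4) - \<i> * of_real v) =
           of_real (2 / cosh (2 * v))"
proof -
  define a b where "a = complex_of_real (pi / 4) + \<i> * of_real v"
    and "b = complex_of_real (pi / 4) - \<i> * of_real v"
  have ab: "a + b = of_real (pi / 2)" "a - b = \<i> * of_real (2 * v)"
    by (simp_all add: a_def b_def)
  have "sin a * sin b = (cos (a - b) - cos (a + b)) / 2"
    by (rule sin_times_sin)
  also have "cos (a + b) = 0"
    unfolding ab cos_of_real by simp
  also have "cos (a - b) = of_real (cosh (2 * v))"
    unfolding ab by (simp add: cos_exp_eq cosh_def scaleR_conv_of_real mult_ac flip: exp_of_real)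
  finally have prod: "sin a * sin b = of_real (cosh (2 * v) / 2)" by simp
  moreover have "cosh (2 * v) / 2 \<noteq> 0" by simp
  ultimately have "sin a * sin b \<noteq> 0" by (simp only: of_real_eq_0_iff not_False_eq_True)
  then have "cot a + cot b = sin (a + b) / (sin a * sin b)"
    by (simp add: cot_def sin_add field_simps)
  also have "sin (a + b) = 1"
    unfolding ab sin_of_real by simp
  finally show ?thesis
    unfolding prod by (simp add: a_def b_def)
qed

text \<open>The quarters match the Digamma series at \<open>1 / 4\<close> and \<open>3 / 4\<close>,
  whose denominators have real parts \<open>(4 * k + 1) / 4\<close> and
  \<open>(4 * k + 3) / 4\<close>. The constant 8 is 4 from the quarters times 2 from adding
  conjugates.\<close>

lemma inverse_add_inverse_conjugates:
  fixes m x :: real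
  assumes "m > 0"
  shows "inverse (complex_of_real (m / 4) + \<i> * of_real (x / 4)) +
         inverse (complex_of_real (m / 4) - \<i> * of_real (x / 4)) = of_real (8 * (m / (m\<^sup>2 + x\<^sup>2)))"
proof -
  have nz: "complex_of_real m + \<i> * of_real x \<noteq> 0" "complex_of_real m - \<i> * of_real x \<noteq> 0"
    using assms by (auto simp: complex_eq_iff)
  have "(complex_of_real m + \<i> * of_real x) * (of_real m - \<i> * of_real x) = of_real (m\<^sup>2 + x\<^sup>2)"
    by (simp add: algebra_simps power2_eq_square)
  moreover have "m\<^sup>2 + x\<^sup>2 \<noteq> 0" using assms by (simp add: add_nonneg_eq_0_iff)
  ultimately have "1 / (complex_of_real m + \<i> * of_real x) + 1 / (of_real m - \<i> * of_real x) =
      of_real (2 * m) / of_real (m\<^sup>2 + x\<^sup>2)"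
    using nz by (simp add: add_frac_eq)
  moreover have "inverse (complex_of_real (m / 4) + \<i> * of_real (x / 4)) = 4 * (1 / (of_real m + \<i> * of_real x))"
    using nz by (simp add: field_simps)
  moreover have "inverse (complex_of_real (m / 4) - \<i> * of_real (x / 4)) = 4 * (1 / (of_real m - \<i> * of_real x))"
    using nz by (simp add: field_simps)
  ultimately have "inverse (complex_of_real (m / 4) + \<i> * of_real (x / 4)) +
      inverse (complex_of_real (m / 4) - \<i> * of_real (x / 4)) =
      4 * (of_real (2 * m) / of_real (m\<^sup>2 + x\<^sup>2))"
    by (simp only: distrib_left[symmetric])
  then show ?thesis by simp
qed

text \<open>Digamma reflection at the conjugate points \<open>1 / 4 + y\<close> and
  \<open>1 / 4 - y\<close> with \<open>y = \<i> * x / 4\<close>, added together: the cotangents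
  combine to a multiple of sech, and the Digamma series to real fractions.\<close>

lemma sech_partial_fractions:
  fixes x :: real
  shows "(\<lambda>j. (4 * real j + 1) / ((4 * real j + 1)\<^sup>2 + x\<^sup>2) - (4 * real j + 3) / ((4 * real j + 3)\<^sup>2 + x\<^sup>2))
           sums (pi / (4 * cosh (pi * x / 2)))"
proof -
  define y where "y = \<i> * complex_of_real (x / 4)"
  have notint: "1 / 4 + \<i> * complex_of_real t \<notin> \<int>" for t
  proof
    assume "1 / 4 + \<i> * complex_of_real t \<in> \<int>"
    then obtain n where "1 / 4 + \<i> * complex_of_real t = of_int n" by (elim Ints_cases)
    then have "Re (1 / 4 + \<i> * complex_of_real t) = of_int n" by simp
    then have "1 = 4 * real_of_int n" by simp
    then have "real_of_int 1 = real_of_int (4 * n)" by simp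
    then have "1 = 4 * n" by (simp only: of_int_eq_iff)
    then show False by presburger
  qed
  have n1: "1 / 4 + y \<notin> \<int>" and n2: "1 / 4 - y \<notin> \<int>"
    using notint[of "x / 4"] notint[of "- x / 4"] by (simp_all add: y_def)
  have nz: "1 / 4 + y \<noteq> 0" "1 / 4 - y \<noteq> 0" "3 / 4 + y \<noteq> 0" "3 / 4 - y \<noteq> 0"
    by (auto simp: y_def complex_eq_iff)
  have r1: "Digamma (3 / 4 - y) - Digamma (1 / 4 + y) = of_real pi * cot (of_real pi * (1 / 4 + y))"
    using Digamma_reflection_complex[OF n1] by (simp add: diff_diff_eq[symmetric])
  have r2: "Digamma (3 / 4 + y) - Digamma (1 / 4 - y) = of_real pi * cot (of_real pi * (1 / 4 - y))"
    using Digamma_reflection_complex[OF n2] by (simp add: algebra_simps)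
  have "(\<lambda>k. (inverse (1 / 4 + y + of_nat k) - inverse (3 / 4 - y + of_nat k)) +
             (inverse (1 / 4 - y + of_nat k) - inverse (3 / 4 + y + of_nat k))) sums
        (of_real pi * cot (of_real pi * (1 / 4 + y)) + of_real pi * cot (of_real pi * (1 / 4 - y)))"
    unfolding r1[symmetric] r2[symmetric] by (intro sums_add Digamma_diff_sums nz)
  also have "of_real pi * cot (of_real pi * (1 / 4 + y)) + of_real pi * cot (of_real pi * (1 / 4 - y)) =
      of_real pi * (cot (of_real (pi / 4) + \<i> * of_real (pi * x / 4)) +
                    cot (of_real (pi / 4) - \<i> * of_real (pi * x / 4)))"
    by (simp add: y_def algebra_simps)
  also have "\<dots> = of_real (2 * pi / cosh (pi * x / 2))"
    unfolding cot_add_cot_conjugates by simp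
  also have "(\<lambda>k. (inverse (1 / 4 + y + of_nat k) - inverse (3 / 4 - y + of_nat k)) +
             (inverse (1 / 4 - y + of_nat k) - inverse (3 / 4 + y + of_nat k))) =
     (\<lambda>k. complex_of_real (8 * ((4 * real k + 1) / ((4 * real k + 1)\<^sup>2 + x\<^sup>2)) -
                           8 * ((4 * real k + 3) / ((4 * real k + 3)\<^sup>2 + x\<^sup>2))))"
  proof
    fix k
    have e: "1 / 4 + y + of_nat k = complex_of_real ((4 * real k + 1) / 4) + \<i> * of_real (x / 4)"
      "1 / 4 - y + of_nat k = complex_of_real ((4 * real k + 1) / 4) - \<i> * of_real (x / 4)"
      "3 / 4 + y + of_nat k = complex_of_real ((4 * real k + 3) / 4) + \<i> * of_real (x / 4)"
      "3 / 4 - y + of_nat k = complex_of_real ((4 * real k + 3) / 4) - \<i> * of_real (x / 4)"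
      by (simp_all add: y_def field_simps)
    have pos: "4 * real k + 1 > 0" "4 * real k + 3 > 0" by simp_all
    \<comment> \<open>Each difference mixes \<open>1 / 4 + y\<close> with \<open>3 / 4 - y\<close>
      or vice versa; the reordering brings conjugates together.\<close>
    have regroup: "(a - d) + (b - c) = (a + b) - (c + d)" for a b c d :: complex
      by simp
    show "(inverse (1 / 4 + y + of_nat k) - inverse (3 / 4 - y + of_nat k)) +
             (inverse (1 / 4 - y + of_nat k) - inverse (3 / 4 + y + of_nat k)) =
        complex_of_real (8 * ((4 * real k + 1) / ((4 * real k + 1)\<^sup>2 + x\<^sup>2)) -
                           8 * ((4 * real k + 3) / ((4 * real k + 3)\<^sup>2 + x\<^sup>2)))"
      by (simp only: e of_real_diff regroup pos[THEN inverse_add_inverse_conjugates])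
  qed
  finally have "(\<lambda>k. 8 * ((4 * real k + 1) / ((4 * real k + 1)\<^sup>2 + x\<^sup>2) -
                     (4 * real k + 3) / ((4 * real k + 3)\<^sup>2 + x\<^sup>2)))
                 sums (2 * pi / cosh (pi * x / 2))"
    by (simp only: sums_of_real_iff right_diff_distrib)
  also have "2 * pi / cosh (pi * x / 2) = 8 * (pi / (4 * cosh (pi * x / 2)))" by simp
  finally show ?thesis
    by (subst (asm) sums_mult_iff) auto
qed

section \<open>Series for the Mellin transform of sech and its logarithmic variant\<close>

text \<open>With the weight \<open>t powr (s - 1)\<close>, the exponential expansion integrates to
  \<open>Gamma s\<close> times the beta series at \<open>s\<close>.\<close>

lemma mellin_sech_beta_sums:
  fixes s :: real
  assumes "s > 0"
  shows "(\<lambda>t. t powr (s - 1) * (1 / (2 * cosh t))) absolutely_integrable_on {0<..}"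
    and "(\<lambda>k. (-1) ^ k * (Gamma s / (2 * real k + 1) powr s)) sums
           integral {0<..} (\<lambda>t. t powr (s - 1) * (1 / (2 * cosh t)))"
proof -
  have pos: "2 * real k + 1 > 0" for k by simp
  note g = Gamma_integral_exp[OF assms pos]
  note S = sech_weighted_integral_sums[of "\<lambda>t. t powr (s - 1)", OF g(1)]
  show "(\<lambda>t. t powr (s - 1) * (1 / (2 * cosh t))) absolutely_integrable_on {0<..}"
    using S(1) by simp
  show "(\<lambda>k. (-1) ^ k * (Gamma s / (2 * real k + 1) powr s)) sums
           integral {0<..} (\<lambda>t. t powr (s - 1) * (1 / (2 * cosh t)))"
    using S(2) unfolding g(2) by simp
qed

lemma mellin_ln_sech_sums:
  fixes s :: real
  assumes "s > 0"
  shows "(\<lambda>t. ln t * t powr (s - 1) * (1 / (2 * cosh t))) absolutely_integrable_on {0<..}"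
    and "(\<lambda>k. (-1) ^ k * (Gamma s / (2 * real k + 1) powr s * (Digamma s - ln (2 * real k + 1)))) sums
           integral {0<..} (\<lambda>t. ln t * t powr (s - 1) * (1 / (2 * cosh t)))"
proof -
  have pos: "2 * real k + 1 > 0" for k by simp
  note g = Gamma_integral_ln_exp[OF assms pos]
  note S = sech_weighted_integral_sums[of "\<lambda>t. ln t * t powr (s - 1)", OF g(1)]
  show "(\<lambda>t. ln t * t powr (s - 1) * (1 / (2 * cosh t))) absolutely_integrable_on {0<..}"
    using S(1) by simp
  show "(\<lambda>k. (-1) ^ k * (Gamma s / (2 * real k + 1) powr s * (Digamma s - ln (2 * real k + 1)))) sums
           integral {0<..} (\<lambda>t. ln t * t powr (s - 1) * (1 / (2 * cosh t)))"
    using S(2) unfolding g(2) by simp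
qed

section \<open>Termwise integration of the partial fractions\<close>

text \<open>Over the common denominator the numerator is \<open>2 * (n * (n + 2) - x^2)\<close>, and
  the second denominator dominates \<open>n * (n + 2) - x^2\<close>. The bound is
  \<open>2 / n\<close> times the single fraction \<open>n / (n^2 + x^2)\<close>.\<close>

lemma Cauchy_kernel_diff_bound:
  fixes n x :: real
  assumes "n > 0"
  shows "\<bar>n / (n\<^sup>2 + x\<^sup>2) - (n + 2) / ((n + 2)\<^sup>2 + x\<^sup>2)\<bar> \<le> 2 / (n\<^sup>2 + x\<^sup>2)"
proof -
  have p: "n\<^sup>2 + x\<^sup>2 > 0" "(n + 2)\<^sup>2 + x\<^sup>2 > 0" using assms by (auto intro: add_pos_nonneg)
  have eq: "n / (n\<^sup>2 + x\<^sup>2) - (n + 2) / ((n + 2)\<^sup>2 + x\<^sup>2) =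
      2 * (n * (n + 2) - x\<^sup>2) / ((n\<^sup>2 + x\<^sup>2) * ((n + 2)\<^sup>2 + x\<^sup>2))"
  proof -
    have "n * ((n + 2)\<^sup>2 + x\<^sup>2) - (n + 2) * (n\<^sup>2 + x\<^sup>2) = 2 * (n * (n + 2) - x\<^sup>2)"
      by (simp add: algebra_simps power2_eq_square)
    moreover have "n / (n\<^sup>2 + x\<^sup>2) - (n + 2) / ((n + 2)\<^sup>2 + x\<^sup>2) =
        (n * ((n + 2)\<^sup>2 + x\<^sup>2) - (n + 2) * (n\<^sup>2 + x\<^sup>2)) / ((n\<^sup>2 + x\<^sup>2) * ((n + 2)\<^sup>2 + x\<^sup>2))"
      using p by (intro diff_frac_eq) auto
    ultimately show ?thesis by (simp only:)
  qed
  have "0 \<le> n * (n + 2)" "n * (n + 2) \<le> (n + 2)\<^sup>2"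
    using assms by (simp_all add: power2_eq_square)
  moreover have "x\<^sup>2 \<ge> 0" by simp
  ultimately have le: "\<bar>n * (n + 2) - x\<^sup>2\<bar> \<le> (n + 2)\<^sup>2 + x\<^sup>2" by linarith
  have "\<bar>n / (n\<^sup>2 + x\<^sup>2) - (n + 2) / ((n + 2)\<^sup>2 + x\<^sup>2)\<bar> =
      2 * \<bar>n * (n + 2) - x\<^sup>2\<bar> / ((n\<^sup>2 + x\<^sup>2) * ((n + 2)\<^sup>2 + x\<^sup>2))"
    unfolding eq abs_divide abs_mult using p by simp
  also have "\<dots> \<le> 2 * ((n + 2)\<^sup>2 + x\<^sup>2) / ((n\<^sup>2 + x\<^sup>2) * ((n + 2)\<^sup>2 + x\<^sup>2))"
    using p le by (intro divide_right_mono mult_left_mono) auto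
  also have "\<dots> = 2 / (n\<^sup>2 + x\<^sup>2)"
    using p(2) by (intro mult_divide_mult_cancel_right) linarith
  finally show ?thesis .
qed

text \<open>Termwise integration of the individual fractions would not converge absolutely; grouping them in
  consecutive pairs gains a factor \<open>1 / j\<close>, which makes the \<open>L\<^sup>1\<close> norms summable for \<open>s < 1\<close>.\<close>

lemma mellin_sech_partial_fractions_sums:
  fixes s :: real
  assumes s: "0 < s" "s < 1"
  shows "(\<lambda>j. pi / 2 / sin (pi * s / 2) * ((4 * real j + 1) powr (s - 1) - (4 * real j + 3) powr (s - 1)))
      sums integral {0<..} (\<lambda>x. x powr (s - 1) * (pi / (4 * cosh (pi * x / 2))))"
proof -
  define C where "C = pi / 2 / sin (pi * s / 2)"
  define K where "K n x = x powr (s - 1) * (n / (n\<^sup>2 + x\<^sup>2))" for n x :: real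
  define f where "f j x = K (4 * real j + 1) x - K (4 * real j + 3) x" for j x
  have s2: "s < 2" using s by simp
  have f_pos: "4 * real j + 1 > 0" for j by simp
  have K: "K n absolutely_integrable_on {0<..}" "integral {0<..} (K n) = C * n powr (s - 1)"
    if "n > 0" for n
    using mellin_Cauchy_kernel[OF s(1) s2 that] unfolding K_def C_def by auto
  have lebesgue_pos: "{0<..} \<in> sets (lebesgue :: real measure)" by simp
  have KL: "integrable (lebesgue_on {0<..}) (K n)"
    "integral\<^sup>L (lebesgue_on {0<..}) (K n) = C * n powr (s - 1)" if "n > 0" for n
    using absolutely_integrable_imp_integrable[OF K(1)[OF that]] K(2)[OF that]
      lebesgue_integral_eq_integral[of "{0<..}" "K n"] by auto
  have f_int: "integrable (lebesgue_on {0<..}) (f j)" for j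
    unfolding f_def by (intro Bochner_Integration.integrable_diff KL) auto
  have f_le: "norm (f j x) \<le> 2 / (4 * real j + 1) * K (4 * real j + 1) x" for j x
  proof -
    have "norm (f j x) = x powr (s - 1) *
        \<bar>(4 * real j + 1) / ((4 * real j + 1)\<^sup>2 + x\<^sup>2) - (4 * real j + 1 + 2) / ((4 * real j + 1 + 2)\<^sup>2 + x\<^sup>2)\<bar>"
      by (simp only: real_norm_def f_def K_def right_diff_distrib[symmetric] abs_mult)
         (simp add: add.assoc)
    also have "\<dots> \<le> x powr (s - 1) * (2 / ((4 * real j + 1)\<^sup>2 + x\<^sup>2))"
      by (intro mult_left_mono Cauchy_kernel_diff_bound) auto
    also have "\<dots> = 2 / (4 * real j + 1) * K (4 * real j + 1) x"
    proof -
      have "x powr (s - 1) * (2 / (m\<^sup>2 + x\<^sup>2)) = 2 / m * (x powr (s - 1) * (m / (m\<^sup>2 + x\<^sup>2)))"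
        if "m > 0" for m :: real
        using that by simp
      then show ?thesis unfolding K_def by (metis f_pos)
    qed
    finally show ?thesis .
  qed
  have suminf_eq: "(\<lambda>j. f j x) sums (x powr (s - 1) * (pi / (4 * cosh (pi * x / 2))))" for x
    using sums_mult[OF sech_partial_fractions[of x], of "x powr (s - 1)"]
    unfolding f_def K_def by (simp add: right_diff_distrib)
  \<comment> \<open>The exponent lies below -1 because \<open>s < 1\<close>. As it is negative,
    \<open>n + 1 <= 4 * n + 1\<close> gives the comparison.\<close>
  have summable_pow: "summable (\<lambda>j. (4 * real j + 1) powr (s - 2))"
  proof (rule summable_comparison_test)
    have "summable (\<lambda>j. real j powr (s - 2))"
      using s by (subst summable_real_powr_iff) auto
    then show "summable (\<lambda>j. real (Suc j) powr (s - 2))"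
      by (subst summable_Suc_iff)
    show "\<exists>N. \<forall>n\<ge>N. norm ((4 * real n + 1) powr (s - 2)) \<le> real (Suc n) powr (s - 2)"
      using s by (intro exI[of _ 0]) (auto intro!: powr_mono2')
  qed
  have norm_summable: "summable (\<lambda>j. norm (f j x))" if "x \<in> {0<..}" for x
  proof (rule summable_comparison_test)
    show "summable (\<lambda>j. 2 * x powr (s - 1) * x powr (- s) * (4 * real j + 1) powr (s - 2))"
      by (intro summable_mult summable_pow)
    show "\<exists>N. \<forall>n\<ge>N. norm (norm (f n x)) \<le> 2 * x powr (s - 1) * x powr (- s) * (4 * real n + 1) powr (s - 2)"
    proof (intro exI[of _ 0] allI impI)
      fix n :: nat
      define m where "m = 4 * real n + 1"
      have m: "m > 0" by (simp add: m_def)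
      \<comment> \<open>The exponents are nonnegative with sum 2, so the product is at most the
        square of the larger of \<open>x\<close> and \<open>m\<close>. This separates the variables
        and leaves a summable power of \<open>m\<close>.\<close>
      have "x powr s * m powr (2 - s) \<le> m\<^sup>2 + x\<^sup>2"
      proof (cases "x \<le> m")
        case True
        then have "x powr s * m powr (2 - s) \<le> m powr s * m powr (2 - s)"
          using that s by (intro mult_right_mono powr_mono2) auto
        also have "\<dots> = m\<^sup>2" using m by (simp flip: powr_add)
        finally show ?thesis by (simp add: add_increasing2)
      next
        case False
        then have "x powr s * m powr (2 - s) \<le> x powr s * x powr (2 - s)"
          using that s m by (intro mult_left_mono powr_mono2) auto
        also have "\<dots> = x\<^sup>2" using that by (simp flip: powr_add)
        finally show ?thesis by (simp add: add_increasing)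
      qed
      then have "1 / (m\<^sup>2 + x\<^sup>2) \<le> 1 / (x powr s * m powr (2 - s))"
        using that m by (intro divide_left_mono mult_pos_pos add_pos_pos) auto
      also have "\<dots> = x powr (- s) * m powr (s - 2)"
        using powr_minus_divide[of m "2 - s"] by (simp add: powr_minus_divide)
      finally have "2 * x powr (s - 1) * (1 / (m\<^sup>2 + x\<^sup>2)) \<le> 2 * x powr (s - 1) * (x powr (- s) * m powr (s - 2))"
        by (intro mult_left_mono) auto
      moreover have "norm (f n x) \<le> 2 * x powr (s - 1) * (1 / (m\<^sup>2 + x\<^sup>2))"
        using f_le[of n x] m unfolding K_def m_def[symmetric] by simp
      ultimately show "norm (norm (f n x)) \<le> 2 * x powr (s - 1) * x powr (- s) * (4 * real n + 1) powr (s - 2)"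
        by (simp add: m_def mult.assoc)
    qed
  qed
  have "summable (\<lambda>j. \<integral>x. norm (f j x) \<partial>lebesgue_on {0<..})"
  proof (rule summable_comparison_test)
    show "summable (\<lambda>j. 2 * C * (4 * real j + 1) powr (s - 2))"
      by (intro summable_mult summable_pow)
    \<comment> \<open>With \<open>m = 4 * j + 1\<close>, the gain \<open>2 / m\<close> from pairing
      meets the integral \<open>C * m powr (s - 1)\<close> of the kernel.\<close>
    have "(\<integral>x. norm (f j x) \<partial>lebesgue_on {0<..}) \<le> 2 * C * (4 * real j + 1) powr (s - 2)" for j
    proof -
      have "(\<integral>x. norm (f j x) \<partial>lebesgue_on {0<..}) \<le>
         (\<integral>x. 2 / (4 * real j + 1) * K (4 * real j + 1) x \<partial>lebesgue_on {0<..})"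
        by (intro integral_mono f_le integrable_norm f_int integrable_mult_right KL) auto
      also have "\<dots> = 2 / (4 * real j + 1) * (C * (4 * real j + 1) powr (s - 1))"
        by (simp add: KL)
      also have "(4 * real j + 1) powr (s - 1) = (4 * real j + 1) * (4 * real j + 1) powr (s - 2)"
        by (simp add: powr_mult_base)
      finally show ?thesis by simp
    qed
    then show "\<exists>N. \<forall>n\<ge>N. norm (\<integral>x. norm (f n x) \<partial>lebesgue_on {0<..}) \<le> 2 * C * (4 * real n + 1) powr (s - 2)"
      by (intro exI[of _ 0]) (simp add: abs_of_nonneg)
  qed
  then have *: "(\<lambda>j. \<integral>x. f j x \<partial>lebesgue_on {0<..}) sums (\<integral>x. (\<Sum>j. f j x) \<partial>lebesgue_on {0<..})"
    "integrable (lebesgue_on {0<..}) (\<lambda>x. \<Sum>j. f j x)"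
    using norm_summable f_int
    by (intro sums_integral integrable_suminf; auto intro!: AE_I2)+
  have "(\<integral>x. f j x \<partial>lebesgue_on {0<..}) = C * ((4 * real j + 1) powr (s - 1) - (4 * real j + 3) powr (s - 1))" for j
    unfolding f_def by (subst Bochner_Integration.integral_diff) (simp_all add: KL right_diff_distrib)
  moreover have "(\<integral>x. (\<Sum>j. f j x) \<partial>lebesgue_on {0<..}) =
      integral {0<..} (\<lambda>x. x powr (s - 1) * (pi / (4 * cosh (pi * x / 2))))"
    unfolding lebesgue_integral_eq_integral[OF *(2) lebesgue_pos] by (simp add: suminf_eq[THEN sums_unique, symmetric])
  ultimately show ?thesis using *(1) by (simp add: C_def)
qed

section \<open>Functional equation and its derivative at the symmetric point\<close>

text \<open>The function called \<open>F\<close> in the overview. The factor \<open>1 / 2\<close>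
  makes the coefficients of the exponential expansion equal to 1 and -1.\<close>

definition mellin_sech :: "real \<Rightarrow> real" where
  "mellin_sech s = integral {0<..} (\<lambda>t. t powr (s - 1) * (1 / (2 * cosh t)))"

text \<open>The same series computed twice: the beta series at \<open>1 - s\<close>, grouped in
  pairs, and the integrated partial fractions at \<open>s\<close> have proportional terms.\<close>

lemma mellin_sech_reflection:
  fixes s :: real
  assumes s: "0 < s" "s < 1"
  shows "mellin_sech (1 - s) = Gamma (1 - s) * sin (pi * s / 2) * (2 / pi) powr s * mellin_sech s"
proof -
  define f where "f t = t powr (s - 1) * (1 / (2 * cosh t))" for t :: real
  define C where "C = pi / 2 / sin (pi * s / 2)"
  have f: "f absolutely_integrable_on {0<..}"
    using mellin_sech_beta_sums(1)[OF s(1)] by (simp add: f_def[abs_def])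
  have sin_pos: "sin (pi * s / 2) > 0"
    using s by (intro sin_gt_zero) auto
  have "(\<lambda>k. (-1) ^ k * (Gamma (1 - s) / (2 * real k + 1) powr (1 - s))) sums mellin_sech (1 - s)"
    using mellin_sech_beta_sums(2)[of "1 - s"] s by (simp add: mellin_sech_def)
  \<comment> \<open>The indices \<open>2 * n\<close> and \<open>2 * n + 1\<close> carry the odd
    numbers \<open>4 * n + 1\<close> and \<open>4 * n + 3\<close> with opposite signs.\<close>
  from sums_group[OF this, of 2]
  have "(\<lambda>n. \<Sum>k = n * 2..<n * 2 + 2. (-1) ^ k * (Gamma (1 - s) / (2 * real k + 1) powr (1 - s)))
          sums mellin_sech (1 - s)" by simp
  moreover have "(\<Sum>k = n * 2..<n * 2 + 2. (-1) ^ k * (Gamma (1 - s) / (2 * real k + 1) powr (1 - s))) =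
      Gamma (1 - s) * ((4 * real n + 1) powr (s - 1) - (4 * real n + 3) powr (s - 1))" for n
  proof -
    have "{n * 2..<n * 2 + 2} = {2 * n, Suc (2 * n)}" by auto
    moreover have "1 / (4 * real n + 1) powr (1 - s) = (4 * real n + 1) powr (s - 1)"
      "1 / (4 * real n + 3) powr (1 - s) = (4 * real n + 3) powr (s - 1)"
      using powr_minus_divide[of "4 * real n + 1" "1 - s"]
        powr_minus_divide[of "4 * real n + 3" "1 - s"] by simp_all
    ultimately show ?thesis
      by (simp add: right_diff_distrib algebra_simps divide_inverse)
  qed
  ultimately have 1: "(\<lambda>n. Gamma (1 - s) * ((4 * real n + 1) powr (s - 1) - (4 * real n + 3) powr (s - 1)))
     sums mellin_sech (1 - s)" by simp
  have "pi / 2 > 0" by simp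
  note sc = absolutely_integrable_scale_pos(2)[OF this f]
  \<comment> \<open>Rescaling by \<open>t = pi * x / 2\<close> undoes the argument of
    \<open>cosh\<close>; its Jacobian cancels the prefactor \<open>pi / 2\<close>.\<close>
  have "integral {0<..} (\<lambda>x. x powr (s - 1) * (pi / (4 * cosh (pi * x / 2)))) =
    integral {0<..} (\<lambda>x. (pi / 2) * (2 / pi) powr (s - 1) * f (pi / 2 * x))"
  proof (rule integral_cong)
    fix x :: real assume "x \<in> {0<..}"
    then show "x powr (s - 1) * (pi / (4 * cosh (pi * x / 2))) =
        (pi / 2) * (2 / pi) powr (s - 1) * f (pi / 2 * x)"
      by (simp add: f_def powr_mult powr_divide)
  qed
  also have "\<dots> = (2 / pi) powr (s - 1) * mellin_sech s"
    unfolding integral_mult_right sc by (simp add: f_def[abs_def] mellin_sech_def)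
  finally have "(\<lambda>n. C * ((4 * real n + 1) powr (s - 1) - (4 * real n + 3) powr (s - 1)))
     sums ((2 / pi) powr (s - 1) * mellin_sech s)"
    using mellin_sech_partial_fractions_sums[OF s] by (simp add: C_def)
  \<comment> \<open>Dividing by \<open>C\<close> yields \<open>sin (pi * s / 2)\<close> and a factor
    \<open>2 / pi\<close>, which raises the exponent of \<open>2 / pi\<close> from
    \<open>s - 1\<close> to \<open>s\<close>.\<close>
  from sums_mult[OF this, of "Gamma (1 - s) / C"]
  have "(\<lambda>n. Gamma (1 - s) * ((4 * real n + 1) powr (s - 1) - (4 * real n + 3) powr (s - 1)))
     sums (Gamma (1 - s) / C * ((2 / pi) powr (s - 1) * mellin_sech s))"
    using sin_pos by (simp add: C_def)
  from sums_unique2[OF 1 this]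
  have "mellin_sech (1 - s) = Gamma (1 - s) * sin (pi * s / 2) * (2 / pi * (2 / pi) powr (s - 1)) * mellin_sech s"
    by (simp add: C_def mult_ac)
  also have "2 / pi * (2 / pi) powr (s - 1) = (2 / pi) powr s"
    by (subst powr_mult_base) auto
  finally show ?thesis .
qed

text \<open>Differentiating \<open>F (1 - s) = P s * F s\<close> at \<open>s = 1 / 2\<close>, where
  \<open>P = 1\<close>, gives \<open>- J = L * F (1 / 2) + J\<close> with \<open>L\<close> the
  logarithmic derivative of \<open>P\<close>.\<close>

lemma mellin_sech_log_derivative_half:
  "integral {0<..} (\<lambda>t. ln t * t powr (1 / 2 - 1) * (1 / (2 * cosh t))) =
     - (ln (sqrt (8 / pi)) + pi / 4 + euler_mascheroni / 2) * mellin_sech (1 / 2)"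
proof -
  define J :: real where "J = integral {0<..} (\<lambda>t. ln t * t powr (1 / 2 - 1) * (1 / (2 * cosh t)))"
  have int: "(\<lambda>t. t powr (s - 1) * (1 / (2 * cosh t))) integrable_on {0<..}" if "s \<in> {0<..<1}" for s :: real
    using mellin_sech_beta_sums(1)[of s] that set_lebesgue_integral_eq_integral(1) by auto
  have D1: "(mellin_sech has_real_derivative J) (at (1 / 2))"
    using mellin_has_real_derivative(2)[of "\<lambda>t. 1 / (2 * cosh t)" 0 1 "1 / 2", OF _ int]
    by (simp add: J_def mellin_sech_def[abs_def])
  have dm: "((\<lambda>s::real. 1 - s) has_real_derivative - 1) (at (1 / 2))"
    by (auto intro!: derivative_eq_intros)
  then have D2: "((\<lambda>s. mellin_sech (1 - s)) has_real_derivative - J) (at (1 / 2))"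
    using DERIV_chain2[of mellin_sech J "\<lambda>s. 1 - s" "1 / 2" "-1" UNIV] D1 by simp
  have sin45: "sin (pi * (1 / 2) / 2) = sqrt 2 / 2" "cos (pi * (1 / 2) / 2) = sqrt 2 / 2"
    using sin_45 cos_45 by simp_all
  define P where "P s = Gamma (1 - s) * sin (pi * s / 2) * (2 / pi) powr s" for s :: real
  \<comment> \<open>The summands stem from \<open>Gamma (1 - s)\<close>, from the sine
    (\<open>pi / 2\<close> times \<open>cot (pi / 4) = 1\<close>) and from the power of
    \<open>2 / pi\<close>.\<close>
  define L where "L = - Digamma (1 / 2) + pi / 2 + ln (2 / pi)"
  have P1: "P (1 / 2) = 1"
    unfolding P_def sin45 using Gamma_one_half_real by (simp add: powr_half_sqrt real_sqrt_divide)
  have "(P has_real_derivative P (1 / 2) * L) (at (1 / 2))"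
  proof -
    have "(1 / 2 :: real) \<notin> \<int>\<^sub>\<le>\<^sub>0" by (auto elim!: nonpos_Ints_cases)
    then have "(Gamma has_real_derivative Gamma (1 / 2) * Digamma (1 / 2)) (at (1 / 2))"
      by (rule has_field_derivative_Gamma)
    then have dG: "((\<lambda>s. Gamma (1 - s)) has_real_derivative - (Gamma (1 / 2) * Digamma (1 / 2))) (at (1 / 2))"
      using DERIV_chain2[of Gamma "Gamma (1 / 2) * Digamma (1 / 2)" "\<lambda>s. 1 - s" "1 / 2" "-1" UNIV] dm
      by simp
    have dS: "((\<lambda>s. sin (pi * s / 2)) has_real_derivative cos (pi * (1 / 2) / 2) * (pi / 2)) (at (1 / 2))"
      by (auto intro!: derivative_eq_intros)
    have dW: "((\<lambda>s. (2 / pi) powr s) has_real_derivative (2 / pi) powr (1 / 2) * ln (2 / pi)) (at (1 / 2))"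
      by (simp add: powr_def) (auto intro!: derivative_eq_intros)
    show ?thesis
      unfolding P_def[abs_def]
      by (rule DERIV_cong[OF DERIV_mult[OF DERIV_mult[OF dG dS] dW]])
         (simp add: L_def sin_45 cos_45 algebra_simps)
  qed
  then have D3: "((\<lambda>s. P s * mellin_sech s) has_real_derivative L * mellin_sech (1 / 2) + J) (at (1 / 2))"
    using DERIV_mult[OF _ D1, of P "P (1 / 2) * L"] P1 by (simp add: algebra_simps)
  have "((\<lambda>s. mellin_sech (1 - s)) has_real_derivative L * mellin_sech (1 / 2) + J) (at (1 / 2))"
    by (rule has_field_derivative_transform_within_open[OF D3, of "{0<..<1}"])
       (auto simp: mellin_sech_reflection P_def)
  from DERIV_unique[OF D2 this] have "J = - (L / 2) * mellin_sech (1 / 2)" by simp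
  \<comment> \<open>\<open>Digamma (1 / 2) = - euler_mascheroni - 2 * ln 2\<close>, so
    \<open>2 * ln 2 + ln (2 / pi)\<close> combines to \<open>ln (8 / pi)\<close>.\<close>
  moreover have "L / 2 = ln (sqrt (8 / pi)) + pi / 4 + euler_mascheroni / 2"
  proof -
    have "ln (8 :: real) = 3 * ln 2" using ln_realpow[of 2 3] by simp
    then show ?thesis
      unfolding L_def Digamma_one_half by (simp add: ln_sqrt ln_div field_simps)
  qed
  ultimately show ?thesis by (simp add: J_def)
qed

section \<open>Substitution and conclusion\<close>

text \<open>Substituting \<open>x = exp (- t)\<close> turns \<open>- ln x\<close> into
  \<open>t\<close>, and the Jacobian together with \<open>1 / (1 + x^2)\<close> into
  \<open>1 / (2 * cosh t)\<close>. The exponent \<open>1 / 2 - 1\<close> keeps the Mellin form at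
  \<open>s = 1 / 2\<close>.\<close>

lemma has_integral_ln_ln_sech:
  "((\<lambda>x::real. ln (- ln x) * (1 / ((1 + x ^ 2) * sqrt (- ln x)))) has_integral
      integral {0<..} (\<lambda>t. ln t * t powr (1 / 2 - 1) * (1 / (2 * cosh t)))) {0<..<1}"
proof -
  define f where "f x = ln (- ln x) * (1 / ((1 + x ^ 2) * sqrt (- ln x)))" for x :: real
  define h where "h t = ln t * t powr (1 / 2 - 1) * (1 / (2 * cosh t))" for t :: real
  have h: "h absolutely_integrable_on {0<..}"
    using mellin_ln_sech_sums(1)[of "1 / 2"] by (simp add: h_def[abs_def])
  have eq: "\<bar>- exp (- t)\<bar> * f (exp (- t)) = h t" if "t \<in> {0<..}" for t
  proof -
    have "exp (- t) * (1 / (1 + (exp (- t)) ^ 2)) = 1 / (2 * cosh t)"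
    proof -
      have "exp (- t) * (2 * cosh t) = 1 + (exp (- t)) ^ 2"
        by (simp add: cosh_def ring_distribs power2_eq_square flip: exp_add)
      moreover have "2 * cosh t > 0" by simp
      moreover have "1 + (exp (- t)) ^ 2 > 0" by (simp add: add_pos_nonneg)
      ultimately show ?thesis by (simp add: field_simps)
    qed
    moreover have "t powr (1 / 2 - 1) = 1 / sqrt t"
      using that powr_minus_divide[of t "1 / 2"] by (simp add: powr_half_sqrt)
    moreover have "\<bar>- exp (- t)\<bar> * f (exp (- t)) = ln t * (1 / sqrt t) * (exp (- t) * (1 / (1 + (exp (- t)) ^ 2)))"
      by (simp add: f_def mult_ac)
    ultimately show ?thesis unfolding h_def by (simp only:)
  qed
  have img: "(\<lambda>t::real. exp (- t)) ` {0<..} = {0<..<1}"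
  proof (intro equalityI subsetI)
    fix y :: real assume "y \<in> {0<..<1}"
    then show "y \<in> (\<lambda>t. exp (- t)) ` {0<..}"
      by (intro image_eqI[of _ _ "- ln y"]) auto
  qed auto
  have "(\<lambda>t. \<bar>- exp (- t)\<bar> * f (exp (- t))) absolutely_integrable_on {0<..} \<and>
      integral {0<..} (\<lambda>t. \<bar>- exp (- t)\<bar> * f (exp (- t))) = integral {0<..} h \<longleftrightarrow>
     f absolutely_integrable_on (\<lambda>t. exp (- t)) ` {0<..} \<and>
      integral ((\<lambda>t. exp (- t)) ` {0<..}) f = integral {0<..} h"
    by (rule has_absolute_integral_change_of_variables_1')
       (auto intro!: derivative_eq_intros simp: inj_on_def)
  then have "f absolutely_integrable_on {0<..<1}" "integral {0<..<1} f = integral {0<..} h"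
    using h unfolding img
    by (simp_all only: set_integrable_cong[OF refl refl eq] integral_cong[OF eq] simp_thms)
  then show ?thesis
    using set_lebesgue_integral_eq_integral(1) unfolding f_def[symmetric] h_def[symmetric]
    by (metis integrable_integral)
qed

text \<open>The summability claims make both \<open>suminf\<close> values genuine limits of partial
  sums. The rest combines the two series at \<open>s = 1 / 2\<close> with the logarithmic derivative
  there.\<close>

theorem proposition5:
  shows "summable (\<lambda>k. (-1) ^ (k + 1) / sqrt (2 * real k + 1) *
             (ln (2 * real k + 1) + 2 * ln 2 + euler_mascheroni))
    \<and> summable (\<lambda>k. (-1) ^ k / (2 * real k + 1) powr (1 / 2))
    \<and> ((\<lambda>x::real. ln (- ln x) * (1 / ((1 + x ^ 2) * sqrt (- ln x)))) has_integral
        sqrt pi * (\<Sum>k. (-1) ^ (k + 1) / sqrt (2 * real k + 1) *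
             (ln (2 * real k + 1) + 2 * ln 2 + euler_mascheroni))) {0<..<1}
    \<and> sqrt pi * (\<Sum>k. (-1) ^ (k + 1) / sqrt (2 * real k + 1) *
             (ln (2 * real k + 1) + 2 * ln 2 + euler_mascheroni))
        = - (ln (sqrt (8 / pi)) + pi / 4 + euler_mascheroni / 2) * sqrt pi * dirichlet_beta (1 / 2)"
proof -
  define J where "J = integral {0<..} (\<lambda>t::real. ln t * t powr (1 / 2 - 1) * (1 / (2 * cosh t)))"
  define a where "a k = (-1) ^ (k + 1) / sqrt (2 * real k + 1) *
             (ln (2 * real k + 1) + 2 * ln 2 + euler_mascheroni)" for k
  define b where "b k = (-1) ^ k / (2 * real k + 1) powr (1 / 2)" for k
  have "(\<lambda>k. sqrt pi * a k) sums J"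
  proof -
    \<comment> \<open>The value of \<open>Digamma (1 / 2)\<close> makes the last factor the negative
      of the bracket in \<open>a\<close>, hence the sign \<open>(-1) ^ (k + 1)\<close>.\<close>
    have "(-1) ^ k * (Gamma (1 / 2) / (2 * real k + 1) powr (1 / 2) * (Digamma (1 / 2) - ln (2 * real k + 1)))
        = sqrt pi * a k" for k
      unfolding a_def Gamma_one_half_real Digamma_one_half
      by (simp add: powr_half_sqrt field_simps)
    then show ?thesis
      using mellin_ln_sech_sums(2)[of "1 / 2"] unfolding J_def by simp
  qed
  from sums_divide[OF this, of "sqrt pi"] have a: "a sums (J / sqrt pi)" by simp
  have "(\<lambda>k. sqrt pi * b k) sums mellin_sech (1 / 2)"
    using mellin_sech_beta_sums(2)[of "1 / 2"]
    unfolding Gamma_one_half_real b_def mellin_sech_def by (simp add: mult.commute)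
  from sums_divide[OF this, of "sqrt pi"] have b: "b sums (mellin_sech (1 / 2) / sqrt pi)" by simp
  have "dirichlet_beta (1 / 2) = mellin_sech (1 / 2) / sqrt pi"
    using sums_unique[OF b] unfolding dirichlet_beta_def b_def by simp
  moreover have "sqrt pi * suminf a = J"
    using sums_unique[OF a, symmetric] by simp
  ultimately show ?thesis
    using sums_summable[OF a] sums_summable[OF b] has_integral_ln_ln_sech
      mellin_sech_log_derivative_half
    unfolding a_def[symmetric] b_def[symmetric] J_def[symmetric] by simp
qed

end
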